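(* Let $d\ge3$ be an integer and for $n\ge0$ let $$x_n=x_n^{(d)}=\sum_{n_1+\dots+n_d=n}\frac{(n!)^2}{(n_1!\cdots n_d!)^2}$$ (sum over nonnegative integers). Then $(x_n)_n$ satisfies a polynomial-coefficient recurrence of width $r=\lfloor\frac{d+1}{2}\rfloor$, and this width is minimal: $(x_n)_n$ satisfies no polynomial-coefficient recurrence of width strictly smaller than $r$.
   Context: A polynomial-coefficient recurrence ($P$-recurrence) of width $s$ for a sequence $(x_n)_{n\ge0}$ is a relation $p_s(n)x_{n+s}+\dots+p_1(n)x_{n+1}+p_0(n)x_n=0$ for all $n\ge0$, with polynomials $p_0,\dots,p_s$ not all zero. *)

theory Defs
  imports Complex_Main "HOL-Computational_Algebra.Polynomial"
begin

definition P_recurrent :: "nat \<Rightarrow> (nat \<Rightarrow> 'a::field_char_0) \<Rightarrow> bool" where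
  "P_recurrent s x \<longleftrightarrow>
     (\<exists>p :: nat \<Rightarrow> 'a poly.
        (\<exists>i\<le>s. p i \<noteq> 0) \<and>
        (\<forall>n. (\<Sum>i\<le>s. poly (p i) (of_nat n) * x (n + i)) = 0))"

text \<open>A tuple \<open>(n\<^sub>1, \<dots>, n\<^sub>d)\<close> is represented as a list of length \<open>d\<close>.\<close>

definition tuples_of_sum :: "nat \<Rightarrow> nat \<Rightarrow> nat list set" where
  "tuples_of_sum d n = {ks. length ks = d \<and> sum_list ks = n}"

lemma finite_tuples_of_sum: "finite (tuples_of_sum d n)"
proof (rule finite_subset)
  show "tuples_of_sum d n \<subseteq> {ks. set ks \<subseteq> {..n} \<and> length ks = d}"
    by (auto simp: tuples_of_sum_def dest: member_le_sum_list)
  show "finite {ks. set ks \<subseteq> {..n} \<and> length ks = d}"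
    by (rule finite_lists_length_eq) simp
qed

definition multinomial_square_sum :: "nat \<Rightarrow> nat \<Rightarrow> 'a::field_char_0" where
  "multinomial_square_sum d n =
     (\<Sum>ks\<in>tuples_of_sum d n. (fact n)\<^sup>2 / (\<Prod>k\<leftarrow>ks. fact k)\<^sup>2)"

end

theory Submission
  imports Defs "HOL-Analysis.FPS_Convergence" "HOL-Computational_Algebra.Formal_Laurent_Series"
begin

text \<open>
  Since \<open>x\<^sub>n / (n!)\<^sup>2\<close> is the coefficient of \<open>z\<^sup>n\<close> in the \<open>d\<close>-th power of \<open>\<Sum> z\<^sup>n / (n!)\<^sup>2\<close>, put
  \<open>z = \<tau>\<^sup>2\<close> and work with \<open>G = f\<^sup>d\<close>, where \<open>f(\<tau>) = I\<^sub>0(2\<tau>)\<close> is a modified Bessel function. Let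
  \<open>\<theta> = z d/dz = (\<tau>/2) d/d\<tau>\<close> and \<open>h = I\<^sub>1(2\<tau>)\<close>; then \<open>\<theta> f = \<tau> h\<close> and \<open>\<theta> h = \<tau> f - h/2\<close>. A recurrence of
  width \<open>s\<close> for \<open>x\<close> is the same thing as a nonzero operator \<open>\<Sum>\<^sub>j z\<^sup>j R\<^sub>j(\<theta>)\<close> of degree at most \<open>s\<close>
  in \<open>z\<close> that annihilates \<open>G\<close> (\<open>recurrent_imp_diff_op\<close>, \<open>diff_op_imp_recurrent\<close>).

  Existence. The equation \<open>\<theta>\<^sup>2 f = z f\<close> has a \<open>d\<close>-th symmetric power, built by the recursion
  \<open>L\<^sub>k\<^sub>+\<^sub>1 = \<theta> L\<^sub>k - k (d - k + 1) z L\<^sub>k\<^sub>-\<^sub>1\<close>. It satisfies \<open>L\<^sub>k G = d (d-1) \<dots> (d-k+1) f\<^sup>d\<^sup>-\<^sup>k (\<theta> f)\<^sup>k\<close>, so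
  \<open>L\<^sub>d\<^sub>+\<^sub>1 G = 0\<close>, and only every second step of the recursion raises the degree in \<open>z\<close>, which is
  therefore at most \<open>(d + 1) div 2\<close>.

  Minimality. First, the products \<open>f\<^sup>d\<^sup>-\<^sup>k h\<^sup>k\<close> with \<open>k \<le> d\<close> are linearly independent over the
  polynomials in \<open>\<tau>\<close> (\<open>bessel_forms_independent\<close>): \<open>f\<close> has infinitely many zeros on the imaginary
  axis (those of \<open>J\<^sub>0\<close>, because \<open>f(\<i>t) = J\<^sub>0(2t)\<close>), and \<open>h\<close> does not vanish there, so the coefficient of \<open>h\<^sup>d\<close> in a
  linear relation has infinitely many roots; it is zero, and the relation can be divided by \<open>f\<close>.
  Secondly, \<open>\<theta>\<^sup>i G\<close> is a combination of these products with coefficients of degree at most \<open>i\<close> in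
  \<open>\<tau>\<close>. Suppose that \<open>\<Sum>\<^sub>j \<tau>\<^sup>2\<^sup>j R\<^sub>j(\<theta>)\<close> kills \<open>G\<close>, and keep in all coefficients only the top power
  \<open>\<tau>\<^sup>N\<close>. To top order \<open>\<theta>/\<tau>\<close> acts as \<open>f \<mapsto> h\<close>, \<open>h \<mapsto> f\<close>, hence diagonally on \<open>(f + h)\<^sup>m (f - h)\<^sup>d\<^sup>-\<^sup>m\<close>
  with eigenvalue \<open>2m - d\<close>, and all these eigenvectors occur in \<open>f\<^sup>d\<close>. The top part
  \<open>\<Sum>\<^sub>j C\<^sub>j \<lambda>\<^sup>N\<^sup>-\<^sup>2\<^sup>j\<close> of the operator must therefore vanish at \<open>\<lambda> = 2m - d\<close> for all \<open>m \<le> d\<close>. Up to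
  a power of \<open>\<lambda>\<close> this is a polynomial in \<open>\<lambda>\<^sup>-\<^sup>2\<close> of degree at most \<open>s\<close>, and \<open>(2m - d)\<^sup>2\<close> takes
  \<open>(d + 1) div 2\<close> distinct nonzero values; so \<open>s < (d + 1) div 2\<close> is impossible.
\<close>

section \<open>The generating function as a power of a Bessel function\<close>

definition recip_fact_sq :: "complex fps" where
  "recip_fact_sq = Abs_fps (\<lambda>n. 1 / (fact n)\<^sup>2)"

text \<open>
  With \<open>z = \<tau>\<^sup>2\<close> these are \<open>I\<^sub>0(2\<tau>)\<close> and \<open>I\<^sub>1(2\<tau>)\<close>. In the variable \<open>\<tau>\<close> the first-order system
  that links them has polynomial coefficients of degree one, so that the degree in \<open>\<tau>\<close> can serve
  as the grading in the minimality proof.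
\<close>

definition bessel0 :: "complex fps" where
  "bessel0 = fps_compose recip_fact_sq (fps_X ^ 2)"

definition bessel1 :: "complex fps" where
  "bessel1 = fps_const (1/2) * fps_deriv bessel0"

lemma bessel0_nth:
  "fps_nth bessel0 n = (if even n then 1 / (fact (n div 2))\<^sup>2 else 0)"
  by (simp add: bessel0_def fps_nth_compose_X_power recip_fact_sq_def)

lemma tuples_of_sum_0: "tuples_of_sum 0 n = (if n = 0 then {[]} else {})"
  by (auto simp: tuples_of_sum_def)

lemma tuples_of_sum_Suc:
  "tuples_of_sum (Suc d) n = (\<Union>k\<in>{0..n}. (#) k ` tuples_of_sum d (n - k))"
proof -
  have "ks \<in> tuples_of_sum (Suc d) n \<longleftrightarrow> ks \<in> (\<Union>k\<in>{0..n}. (#) k ` tuples_of_sum d (n - k))" for ks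
    by (cases ks) (auto simp: tuples_of_sum_def image_iff intro!: bexI[of _ "hd ks"])
  then show ?thesis by blast
qed

lemma recip_fact_sq_power_nth:
  "fps_nth (recip_fact_sq ^ d) n = (\<Sum>ks\<in>tuples_of_sum d n. 1 / (\<Prod>k\<leftarrow>ks. fact k)\<^sup>2)"
proof (induction d arbitrary: n)
  case 0
  then show ?case by (simp add: tuples_of_sum_0)
next
  case (Suc d)
  let ?g = "\<lambda>ks. 1 / (\<Prod>k\<leftarrow>ks. fact k)\<^sup>2 :: complex"
  have "fps_nth (recip_fact_sq ^ Suc d) n =
      (\<Sum>k=0..n. \<Sum>ks\<in>tuples_of_sum d (n - k). ?g (k # ks))"
    by (simp add: fps_mult_nth Suc.IH sum_distrib_left power_mult_distrib)
       (simp add: recip_fact_sq_def)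
  also have "\<dots> = (\<Sum>k=0..n. sum ?g ((#) k ` tuples_of_sum d (n - k)))"
    by (simp add: sum.reindex o_def)
  also have "\<dots> = sum ?g (tuples_of_sum (Suc d) n)"
    unfolding tuples_of_sum_Suc
    by (subst sum.UNION_disjoint) (auto simp: finite_tuples_of_sum)
  finally show ?case .
qed

lemma bessel0_power_nth:
  "fps_nth (bessel0 ^ d) n =
     (if even n then multinomial_square_sum d (n div 2) / (fact (n div 2))\<^sup>2 else 0)"
proof -
  have "bessel0 ^ d = fps_compose (recip_fact_sq ^ d) (fps_X ^ 2)"
    unfolding bessel0_def by (rule fps_compose_power) simp
  then show ?thesis
    by (auto simp: fps_nth_compose_X_power recip_fact_sq_power_nth multinomial_square_sum_def
        sum_divide_distrib)
qed

section \<open>Recurrences and differential operators\<close>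

text \<open>
  This is \<open>z d/dz\<close> for \<open>z = \<tau>\<^sup>2\<close>, whence the factor \<open>1/2\<close>.
\<close>

definition theta :: "complex fps \<Rightarrow> complex fps" where
  "theta G = fps_const (1/2) * (fps_X * fps_deriv G)"

lemma theta_nth: "fps_nth (theta G) n = of_nat n / 2 * fps_nth G n"
  by (cases n) (simp_all add: theta_def)

lemma theta_mult: "theta (F * G) = theta F * G + F * theta G"
  by (simp add: theta_def algebra_simps)

lemma theta_power: "theta (F ^ n) = of_nat n * F ^ (n - 1) * theta F"
  by (simp add: theta_def fps_deriv_power algebra_simps fps_of_nat)

lemma theta_sum: "theta (sum F A) = (\<Sum>i\<in>A. theta (F i))"
  by (simp add: fps_eq_iff theta_nth fps_sum_nth sum_distrib_left)

lemma theta_funpow_nth: "fps_nth ((theta ^^ i) G) n = (of_nat n / 2) ^ i * fps_nth G n"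
  by (induction i) (simp_all add: theta_nth)

lemma theta_bessel0: "theta bessel0 = fps_X * bessel1"
  by (simp add: theta_def bessel1_def algebra_simps)

lemma theta_bessel1: "theta bessel1 = fps_X * bessel0 - fps_const (1/2) * bessel1"
proof (rule fps_ext)
  fix n
  show "fps_nth (theta bessel1) n = fps_nth (fps_X * bessel0 - fps_const (1/2) * bessel1) n"
  proof (cases "odd n")
    case True
    then obtain m where n: "n = Suc (2 * m)" by (metis oddE Suc_eq_plus1)
    define c :: complex where "c = of_nat m + 1"
    have c: "c \<noteq> 0" unfolding c_def by (metis of_nat_Suc of_nat_neq_0 add.commute)
    have "fps_nth bessel1 n = 1 / (c * (fact m)\<^sup>2)"
    proof -
      have "of_nat (Suc n) = 2 * c" and "fact (Suc m) = c * fact m"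
        by (simp_all add: n c_def algebra_simps)
      then have "fps_nth bessel1 n = 1 / 2 * (2 * c) * (1 / (c * fact m)\<^sup>2)"
        by (simp add: bessel1_def bessel0_nth n del: of_nat_Suc fact_Suc)
      then show ?thesis using c by (simp add: power2_eq_square)
    qed
    moreover have "fps_nth bessel0 (2 * m) = 1 / (fact m)\<^sup>2"
      by (simp add: bessel0_nth)
    moreover have "of_nat n = 2 * c - 1"
      by (simp add: n c_def)
    ultimately have "fps_nth (theta bessel1) n = (2 * c - 1) / 2 * (1 / (c * (fact m)\<^sup>2))"
      and "fps_nth (fps_X * bessel0 - fps_const (1/2) * bessel1) n =
          1 / (fact m)\<^sup>2 - 1 / 2 * (1 / (c * (fact m)\<^sup>2))"
      by (simp_all add: theta_nth n)
    then show ?thesis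
      using c by (simp only:) (simp add: field_simps)
  next
    case False
    then show ?thesis
      by (cases n) (auto simp: theta_nth bessel1_def bessel0_nth)
  qed
qed

text \<open>
  The operator \<open>R(\<theta>)\<close>.
\<close>

definition euler_op :: "complex poly \<Rightarrow> complex fps \<Rightarrow> complex fps" where
  "euler_op R G = Abs_fps (\<lambda>n. poly R (of_nat n / 2) * fps_nth G n)"

lemma euler_op_nth [simp]:
  "fps_nth (euler_op R G) n = poly R (of_nat n / 2) * fps_nth G n"
  by (simp add: euler_op_def)

lemma euler_op_altdef:
  "euler_op R G = (\<Sum>i\<le>degree R. fps_const (coeff R i) * (theta ^^ i) G)"
  by (simp add: fps_eq_iff fps_sum_nth theta_funpow_nth poly_altdef sum_distrib_right mult.assoc)

text \<open>
  The operator \<open>\<Sum>\<^sub>j z\<^sup>j R\<^sub>j(\<theta>)\<close>, where \<open>z = \<tau>\<^sup>2\<close>.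
\<close>

definition diff_op :: "nat \<Rightarrow> (nat \<Rightarrow> complex poly) \<Rightarrow> complex fps \<Rightarrow> complex fps" where
  "diff_op s R G = (\<Sum>j\<le>s. fps_X ^ (2 * j) * euler_op (R j) G)"

lemma diff_op_nth:
  "fps_nth (diff_op s R G) n =
     (\<Sum>j\<le>s. if n < 2 * j then 0
            else poly (R j) (of_nat (n - 2 * j) / 2) * fps_nth G (n - 2 * j))"
  unfolding diff_op_def fps_sum_nth by (intro sum.cong) (auto simp: fps_X_power_mult_nth)

lemma of_nat_double_half: "of_nat (2 * k) / 2 = (of_nat k :: complex)"
  by simp

lemma fact_ratio:
  assumes "i \<le> r"
  shows "(\<Prod>l\<in>{i<..r}. of_nat (n + l)) * fact (n + i) = (fact (n + r) :: complex)"
  using assms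
proof (induction r rule: dec_induct)
  case base
  then show ?case by simp
next
  case (step k)
  have "{i<..Suc k} = insert (Suc k) {i<..k}" using step by auto
  then show ?case using step by (simp add: algebra_simps)
qed

lemma fact_ratio':
  assumes "i \<le> n"
  shows "(\<Prod>l<i. of_nat n - of_nat l) * fact (n - i) = (fact n :: complex)"
  using assms
proof (induction i)
  case (Suc i)
  then have "fact (n - i) = (of_nat (n - i)) * (fact (n - Suc i) :: complex)"
    by (metis Suc_diff_Suc Suc_le_eq fact_Suc)
  with Suc show ?case by (simp add: of_nat_diff mult.assoc)
qed simp

text \<open>
  The factors \<open>((n+i)!)\<^sup>2\<close> that relate \<open>x\<^sub>n\<^sub>+\<^sub>i\<close> to the coefficients of \<open>G\<close> are \<open>(n!)\<^sup>2\<close> times squares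
  of falling factorials of \<open>n + i\<close>, which are absorbed into the polynomials. Those falling
  factorials vanish at \<open>0, \<dots>, i - 1\<close>; this is why the operator also kills the coefficients of
  \<open>z\<^sup>0, \<dots>, z\<^sup>s\<^sup>-\<^sup>1\<close>, about which the recurrence says nothing.
\<close>

lemma recurrent_imp_diff_op:
  fixes x :: "nat \<Rightarrow> complex"
  assumes G: "\<And>n. fps_nth G n = (if even n then x (n div 2) / (fact (n div 2))\<^sup>2 else 0)"
    and rec: "P_recurrent s x"
  obtains R where "\<exists>j\<le>s. R j \<noteq> 0" "diff_op s R G = 0"
proof -
  from rec obtain p where p: "\<exists>i\<le>s. p i \<noteq> 0"
    and rel: "\<And>n. (\<Sum>i\<le>s. poly (p i) (of_nat n) * x (n + i)) = 0"
    unfolding P_recurrent_def by auto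
  define Q where "Q i = pcompose (p i) [:- of_nat i, 1:] * (\<Prod>l<i. [:- of_nat l, 1:])\<^sup>2" for i
  define R where "R j = Q (s - j)" for j
  have "\<exists>j\<le>s. R j \<noteq> 0"
  proof -
    obtain i where i: "i \<le> s" "p i \<noteq> 0" using p by auto
    have "pcompose (p i) [:- of_nat i, 1:] \<noteq> 0"
      using i by (subst pcompose_eq_0_iff) auto
    then have "Q i \<noteq> 0" by (auto simp: Q_def prod_zero_iff)
    then have "R (s - i) \<noteq> 0" using i by (simp add: R_def)
    then show ?thesis by (intro exI[of _ "s - i"]) auto
  qed
  moreover have "diff_op s R G = 0"
  proof (rule fps_ext)
    fix n
    have "fps_nth (diff_op s R G) n = (\<Sum>i\<le>s. if n < 2 * (s - i) then 0
            else poly (Q i) (of_nat (n - 2 * (s - i)) / 2) * fps_nth G (n - 2 * (s - i)))"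
      unfolding diff_op_nth R_def
      by (rule sum.reindex_bij_witness[of _ "\<lambda>i. s - i" "\<lambda>i. s - i"]) auto
    also have "\<dots> = 0"
    proof (cases "even n")
      case False
      then show ?thesis by (intro sum.neutral) (auto simp: G)
    next
      case True
      then obtain m where m: "n = 2 * m" by (auto elim: evenE)
      \<comment> \<open>For \<open>k < i\<close> the falling factorial vanishes, so no initial terms are left over.\<close>
      have Qeq: "poly (Q i) (of_nat k) * (x k / (fact k)\<^sup>2) =
          (if k < i then 0 else poly (p i) (of_nat (k - i)) * x k / (fact (k - i))\<^sup>2)" for i k
      proof (cases "k < i")
        case True
        then have "(\<Prod>l<i. of_nat k - of_nat l :: complex) = 0"
          by (intro prod_zero) auto
        then show ?thesis using True by (simp add: Q_def poly_prod poly_pcompose)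
      next
        case False
        then have f: "(\<Prod>l<i. of_nat k - of_nat l) * fact (k - i) = (fact k :: complex)"
          by (intro fact_ratio') simp
        have "poly (Q i) (of_nat k) = poly (p i) (of_nat (k - i)) * (\<Prod>l<i. of_nat k - of_nat l)\<^sup>2"
          using False by (simp add: Q_def poly_prod poly_pcompose of_nat_diff)
        with False show ?thesis
          by (simp add: f[symmetric] field_simps power2_eq_square)
      qed
      have term_eq: "(if n < 2 * (s - i) then 0
            else poly (Q i) (of_nat (n - 2 * (s - i)) / 2) * fps_nth G (n - 2 * (s - i))) =
          (if m < s then 0 else poly (p i) (of_nat (m - s)) * x (m - s + i) / (fact (m - s))\<^sup>2)"
        if "i \<le> s" for i
      proof (cases "n < 2 * (s - i)")
        case True
        then show ?thesis using m by auto
      next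
        case False
        define k where "k = m - (s - i)"
        have e: "n - 2 * (s - i) = 2 * k" using m by (simp add: k_def)
        show ?thesis
        proof (cases "m < s")
          case True
          with False that m have "k < i" by (auto simp: k_def)
          with True False show ?thesis unfolding e of_nat_double_half using Qeq[of i k] by (simp add: G)
        next
          case ms: False
          with that have "k = m - s + i" by (simp add: k_def)
          moreover obtain q where "m = s + q" using ms by (metis le_Suc_ex not_less)
          ultimately show ?thesis
            using False Qeq[of i "q + i"] unfolding e of_nat_double_half by (simp add: G)
        qed
      qed
      have "(\<Sum>i\<le>s. if n < 2 * (s - i) then 0
            else poly (Q i) (of_nat (n - 2 * (s - i)) / 2) * fps_nth G (n - 2 * (s - i))) =
          (\<Sum>i\<le>s. if m < s then 0 else poly (p i) (of_nat (m - s)) * x (m - s + i) / (fact (m - s))\<^sup>2)"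
        by (intro sum.cong refl term_eq) simp
      also have "\<dots> = (if m < s then 0 else (\<Sum>i\<le>s. poly (p i) (of_nat (m - s)) * x (m - s + i)) / (fact (m - s))\<^sup>2)"
        by (simp add: sum_divide_distrib)
      finally show ?thesis unfolding rel by simp
    qed
    finally show "fps_nth (diff_op s R G) n = fps_nth 0 n" by simp
  qed
  ultimately show ?thesis by (rule that)
qed

text \<open>
  Conversely the coefficient of \<open>z\<^sup>n\<^sup>+\<^sup>s\<close> is multiplied by \<open>((n+s)!)\<^sup>2\<close>; the quotients
  \<open>(n+s)! / (n+i)!\<close> are polynomials in \<open>n\<close>.
\<close>

lemma diff_op_imp_recurrent:
  fixes x :: "nat \<Rightarrow> complex"
  assumes G: "\<And>n. fps_nth G n = (if even n then x (n div 2) / (fact (n div 2))\<^sup>2 else 0)"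
    and R: "j \<le> s" "R j \<noteq> 0" and zero: "diff_op s R G = 0"
  shows "P_recurrent s x"
proof -
  define p where "p i = pcompose (R (s - i)) [:of_nat i, 1:] * (\<Prod>l\<in>{i<..s}. [:of_nat l, 1:])\<^sup>2" for i
  have "pcompose (R j) [:of_nat (s - j), 1:] \<noteq> 0"
    using R by (subst pcompose_eq_0_iff) auto
  then have "p (s - j) \<noteq> 0" using R by (auto simp: p_def prod_zero_iff)
  then have "\<exists>i\<le>s. p i \<noteq> 0" by (intro exI[of _ "s - j"]) auto
  moreover have "(\<Sum>i\<le>s. poly (p i) (of_nat n) * x (n + i)) = 0" for n
  proof -
    have "poly (p i) (of_nat n) * x (n + i) =
        (fact (n + s))\<^sup>2 * (poly (R (s - i)) (of_nat (n + i)) * (x (n + i) / (fact (n + i))\<^sup>2))"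
      if "i \<le> s" for i
    proof -
      have "(\<Prod>l\<in>{i<..s}. of_nat l + of_nat n) * fact (n + i) = (fact (n + s) :: complex)"
        using fact_ratio[OF that, of n] by (simp add: add.commute)
      then show ?thesis
        by (simp add: p_def poly_prod poly_pcompose power_mult_distrib add.commute
            flip: \<open>_ = fact (n + s)\<close>)
    qed
    then have "(\<Sum>i\<le>s. poly (p i) (of_nat n) * x (n + i)) =
        (fact (n + s))\<^sup>2 * (\<Sum>i\<le>s. poly (R (s - i)) (of_nat (n + i)) * (x (n + i) / (fact (n + i))\<^sup>2))"
      by (simp add: sum_distrib_left)
    also have "(\<Sum>i\<le>s. poly (R (s - i)) (of_nat (n + i)) * (x (n + i) / (fact (n + i))\<^sup>2)) =
        fps_nth (diff_op s R G) (2 * (n + s))"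
    proof -
      have ix: "2 * (n + s) - 2 * (s - i) = 2 * (n + i)" if "i \<le> s" for i
        using that by simp
      have rev: "(\<Sum>i\<le>s. g (s - i)) = (\<Sum>j\<le>s. g j)" for g :: "nat \<Rightarrow> complex"
        by (rule sum.reindex_bij_witness[of _ "\<lambda>j. s - j" "\<lambda>j. s - j"]) auto
      show ?thesis
        unfolding diff_op_nth
      proof (rule trans[OF _ rev], intro sum.cong refl)
        fix i assume "i \<in> {..s}"
        then have i: "i \<le> s" and ge: "\<not> 2 * (n + s) < 2 * (s - i)" by auto
        show "poly (R (s - i)) (of_nat (n + i)) * (x (n + i) / (fact (n + i))\<^sup>2) =
            (if 2 * (n + s) < 2 * (s - i) then 0
             else poly (R (s - i)) (of_nat (2 * (n + s) - 2 * (s - i)) / 2) *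
               fps_nth G (2 * (n + s) - 2 * (s - i)))"
          unfolding ix[OF i] of_nat_double_half using ge by (simp add: G)
      qed
    qed
    finally show ?thesis by (simp add: zero)
  qed
  ultimately show ?thesis unfolding P_recurrent_def by blast
qed

section \<open>Existence: the symmetric power of the Bessel equation\<close>

text \<open>
  \<open>sym_op d k j\<close> is the coefficient of \<open>z\<^sup>j\<close>, a polynomial in \<open>\<theta>\<close>, of the operator \<open>L\<^sub>k\<close> of the
  symmetric power construction. Moving \<open>\<theta>\<close> past \<open>z\<^sup>j\<close> turns it into \<open>\<theta> + j\<close>, which explains the
  factor \<open>[:of_nat j, 1:]\<close>.
\<close>

fun sym_op :: "nat \<Rightarrow> nat \<Rightarrow> nat \<Rightarrow> complex poly" where
  "sym_op d 0 j = (if j = 0 then 1 else 0)"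
| "sym_op d (Suc 0) j = (if j = 0 then [:0, 1:] else 0)"
| "sym_op d (Suc (Suc k)) j = [:of_nat j, 1:] * sym_op d (Suc k) j -
     (if j = 0 then 0
      else smult (of_nat (Suc k) * of_nat (d - k)) (sym_op d k (j - 1)))"

text \<open>
  Every factor \<open>z\<close> costs two steps of the recursion. For \<open>k = d + 1\<close> this bounds the width.
\<close>

lemma sym_op_eq_0: "k < 2 * j \<Longrightarrow> sym_op d k j = 0"
  by (induction d k j rule: sym_op.induct) auto

text \<open>
  The part of \<open>L\<^sub>k\<close> free of \<open>z\<close> is \<open>\<theta>\<^sup>k\<close>; in particular \<open>L\<^sub>k\<close> is a nonzero operator.
\<close>

lemma sym_op_0: "sym_op d k 0 = [:0, 1:] ^ k"
proof (induction k rule: induct_nat_012)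
  case (ge2 n)
  then show ?case by simp
qed auto

lemma diff_op_mono:
  assumes "s \<le> t" "\<And>j. s < j \<Longrightarrow> R j = 0"
  shows "diff_op t R G = diff_op s R G"
  unfolding diff_op_def
  by (rule sum.mono_neutral_right) (use assms in \<open>auto simp: fps_eq_iff fps_X_power_mult_nth\<close>)

lemma diff_op_sym_op_rec:
  assumes "s \<ge> Suc (Suc k)"
  shows "diff_op s (sym_op d (Suc (Suc k))) G = theta (diff_op s (sym_op d (Suc k)) G) -
    of_nat (Suc k) * of_nat (d - k) * (fps_X ^ 2 * diff_op s (sym_op d k) G)"
proof (rule fps_ext)
  fix n
  let ?f = "\<lambda>k j. if n < 2 * j then 0
     else poly (sym_op d k j) (of_nat (n - 2 * j) / 2) * fps_nth G (n - 2 * j)"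
  let ?c = "of_nat (Suc k) * of_nat (d - k) :: complex"
  let ?h = "\<lambda>j. if n < 2 * j then 0
     else poly (sym_op d k (j - 1)) (of_nat (n - 2 * j) / 2) * fps_nth G (n - 2 * j)"
  have "fps_nth (fps_X ^ 2 * diff_op s (sym_op d k) G) n = (\<Sum>j\<le>s. ?h (Suc j))"
    unfolding fps_X_power_mult_nth diff_op_nth by (auto intro!: sum.cong)
  also have "\<dots> = (\<Sum>j\<in>{1..s}. ?h j)"
  proof -
    have "sym_op d k s = 0" using assms by (intro sym_op_eq_0) simp
    then have "(\<Sum>j\<le>s. ?h (Suc j)) = (\<Sum>j<s. ?h (Suc j))"
      by (simp add: lessThan_Suc_atMost[symmetric])
    also have "\<dots> = (\<Sum>j\<in>{1..s}. ?h j)"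
      by (rule sum.reindex_bij_witness[of _ "\<lambda>j. j - 1" Suc]) auto
    finally show ?thesis .
  qed
  finally have X2: "fps_nth (fps_X ^ 2 * diff_op s (sym_op d k) G) n = (\<Sum>j\<in>{1..s}. ?h j)" .
  have step: "?f (Suc (Suc k)) j = of_nat n / 2 * ?f (Suc k) j - ?c * (if j = 0 then 0 else ?h j)" for j
  proof (cases "n < 2 * j")
    case False
    define y :: complex where "y = of_nat (n - 2 * j) / 2"
    have n: "of_nat n / 2 = of_nat j + y"
      using False by (simp add: y_def field_simps)
    show ?thesis
      using False unfolding y_def[symmetric] n by (simp add: algebra_simps)
  qed simp
  have "fps_nth (diff_op s (sym_op d (Suc (Suc k))) G) n =
      of_nat n / 2 * (\<Sum>j\<le>s. ?f (Suc k) j) - ?c * (\<Sum>j\<le>s. if j = 0 then 0 else ?h j)"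
    unfolding diff_op_nth step by (simp add: sum_subtractf sum_distrib_left)
  also have "(\<Sum>j\<le>s. if j = 0 then 0 else ?h j) = (\<Sum>j\<in>{1..s}. ?h j)"
    by (rule sum.mono_neutral_cong_right) auto
  finally show "fps_nth (diff_op s (sym_op d (Suc (Suc k))) G) n = fps_nth
     (theta (diff_op s (sym_op d (Suc k)) G) -
      of_nat (Suc k) * of_nat (d - k) * (fps_X ^ 2 * diff_op s (sym_op d k) G)) n"
    unfolding X2[symmetric]
    by (simp add: theta_nth diff_op_nth mult.assoc del: sym_op.simps of_nat_Suc flip: fps_of_nat fps_const_mult)
qed

lemma theta_of_nat_mult: "theta (of_nat m * F) = of_nat m * theta F"
  by (simp add: fps_eq_iff theta_nth flip: fps_of_nat)

lemma theta_monomial: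
  assumes "k \<le> d"
  shows "theta (bessel0 ^ (d - k) * (fps_X * bessel1) ^ k) =
    of_nat (d - k) * (bessel0 ^ (d - Suc k) * (fps_X * bessel1) ^ Suc k) +
    of_nat k * (fps_X ^ 2 * (bessel0 ^ (d - (k - 1)) * (fps_X * bessel1) ^ (k - 1)))"
proof -
  let ?H = "fps_X * bessel1"
  have H: "theta ?H = fps_X ^ 2 * bessel0"
    by (simp add: theta_mult theta_bessel1)
      (simp add: theta_def power2_eq_square algebra_simps)
  have "theta (bessel0 ^ (d - k) * ?H ^ k) =
     of_nat (d - k) * bessel0 ^ (d - k - 1) * ?H * ?H ^ k +
     bessel0 ^ (d - k) * (of_nat k * ?H ^ (k - 1) * (fps_X ^ 2 * bessel0))"
    unfolding theta_mult[of "bessel0 ^ (d - k)"] theta_power theta_bessel0 H by (simp add: mult_ac)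
  also have "k = 0 \<or> bessel0 ^ (d - (k - 1)) = bessel0 * bessel0 ^ (d - k)"
    using assms by (cases k) (auto simp flip: power_Suc simp: Suc_diff_Suc)
  then have "bessel0 ^ (d - k) * (of_nat k * ?H ^ (k - 1) * (fps_X ^ 2 * bessel0)) =
     of_nat k * (fps_X ^ 2 * (bessel0 ^ (d - (k - 1)) * ?H ^ (k - 1)))"
    by auto
  finally show ?thesis by (simp add: mult_ac)
qed

text \<open>
  At \<open>k = d + 1\<close> the product of the \<open>d - l\<close> contains the factor zero: there \<open>f\<^sup>d\<close> is annihilated.
\<close>

lemma sym_op_bessel0_power:
  assumes "k \<le> Suc d"
  shows "diff_op (Suc d) (sym_op d k) (bessel0 ^ d) =
    (\<Prod>l<k. of_nat (d - l)) * (bessel0 ^ (d - k) * (fps_X * bessel1) ^ k)"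
  using assms
proof (induction k rule: induct_nat_012)
  case 0
  have "diff_op (Suc d) (sym_op d 0) (bessel0 ^ d) = diff_op 0 (sym_op d 0) (bessel0 ^ d)"
    by (rule diff_op_mono) auto
  then show ?case by (simp add: diff_op_def fps_eq_iff)
next
  case 1
  have "diff_op (Suc d) (sym_op d 1) (bessel0 ^ d) = diff_op 0 (sym_op d 1) (bessel0 ^ d)"
    by (rule diff_op_mono) auto
  also have "\<dots> = theta (bessel0 ^ d)"
    by (simp add: diff_op_def fps_eq_iff theta_nth)
  finally show ?case using theta_monomial[of 0 d] by (simp del: sym_op.simps)
next
  case (ge2 k)
  let ?W = "\<lambda>k. bessel0 ^ (d - k) * (fps_X * bessel1) ^ k"
  let ?P = "\<lambda>k. (\<Prod>l<k. of_nat (d - l)) :: complex fps"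
  have cst: "theta (?P k * F) = ?P k * theta F" for k F
    by (simp only: of_nat_prod[symmetric] theta_of_nat_mult)
  have "diff_op (Suc d) (sym_op d (Suc (Suc k))) (bessel0 ^ d) =
     ?P (Suc k) * theta (?W (Suc k)) - of_nat (Suc k) * of_nat (d - k) * (fps_X ^ 2 * (?P k * ?W k))"
    using ge2 by (simp add: diff_op_sym_op_rec cst del: sym_op.simps of_nat_Suc prod.lessThan_Suc of_nat_diff power_Suc)
  also have "theta (?W (Suc k)) = of_nat (d - Suc k) * ?W (Suc (Suc k)) +
      of_nat (Suc k) * (fps_X ^ 2 * ?W k)"
    using theta_monomial[of "Suc k" d] ge2.prems by (simp del: of_nat_Suc power_Suc)
  finally show ?case
    by (simp add: algebra_simps del: of_nat_Suc power_Suc of_nat_diff)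
qed

lemma multinomial_square_sum_recurrent:
  fixes x :: "nat \<Rightarrow> complex"
  assumes "\<And>n. x n = multinomial_square_sum d n"
  shows "P_recurrent ((d + 1) div 2) x"
proof (rule diff_op_imp_recurrent)
  show "fps_nth (bessel0 ^ d) n = (if even n then x (n div 2) / (fact (n div 2))\<^sup>2 else 0)" for n
    by (simp add: bessel0_power_nth assms)
  show "0 \<le> (d + 1) div 2" by simp
  show "sym_op d (Suc d) 0 \<noteq> 0"
    unfolding sym_op_0 by simp
  have "diff_op (Suc d) (sym_op d (Suc d)) (bessel0 ^ d) = 0"
    by (simp add: sym_op_bessel0_power del: sym_op.simps)
  then show "diff_op ((d + 1) div 2) (sym_op d (Suc d)) (bessel0 ^ d) = 0"
    by (subst (asm) diff_op_mono[of "(d + 1) div 2"]) (auto intro!: sym_op_eq_0)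
qed

section \<open>Zeros of the Bessel function\<close>

text \<open>
  For \<open>u(t) = J\<^sub>0(2t)\<close> and \<open>v(t) = J\<^sub>1(2t)\<close> the equations below are \<open>(t v)' = 2 t u\<close> and \<open>u' = -2 v\<close>.
  If \<open>u > 0\<close> from \<open>a\<close> on, then \<open>t v\<close> increases. Were it ever positive, \<open>u\<close> would fall at least like
  \<open>- ln t\<close> and become negative. So \<open>v \<le> 0\<close>, hence \<open>u\<close> increases, and \<open>t v\<close> grows like \<open>t\<^sup>2\<close>, which
  contradicts \<open>v \<le> 0\<close>.
\<close>

lemma no_positive_solution:
  fixes u v :: "real \<Rightarrow> real"
  assumes du: "\<And>t. t > 0 \<Longrightarrow> (u has_real_derivative - 2 * v t) (at t)"
    and dv: "\<And>t. t > 0 \<Longrightarrow> (v has_real_derivative 2 * u t - v t / t) (at t)"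
    and "a > 0" and pos: "\<And>t. t \<ge> a \<Longrightarrow> u t > 0"
  shows False
proof -
  have dw: "((\<lambda>t. t * v t) has_real_derivative 2 * t * u t) (at t)" if "t > 0" for t
    using that by (auto intro!: derivative_eq_intros dv simp: field_simps)
  have w_mono: "s * v s \<le> t * v t" if "a \<le> s" "s \<le> t" for s t
  proof (rule DERIV_nonneg_imp_nondecreasing[OF that(2)])
    fix y assume "s \<le> y"
    then show "\<exists>z. ((\<lambda>t. t * v t) has_real_derivative z) (at y) \<and> 0 \<le> z"
      using dw[of y] that \<open>a > 0\<close> pos[of y] by (intro exI[of _ "2 * y * u y"]) auto
  qed
  have v_le: "v b \<le> 0" if b: "b \<ge> a" for b
  proof (rule ccontr)
    assume "\<not> v b \<le> 0"
    then have vb: "v b > 0" by simp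
    define c where "c = b * v b"
    have c: "c > 0" using vb b \<open>a > 0\<close> by (simp add: c_def)
    have dec: "u t + 2 * c * ln t \<le> u b + 2 * c * ln b" if "b \<le> t" for t
    proof (rule DERIV_nonpos_imp_nonincreasing[OF that])
      fix y assume y: "b \<le> y"
      then have "y > 0" using b \<open>a > 0\<close> by simp
      moreover have "c \<le> y * v y" unfolding c_def using w_mono[of b y] b y by simp
      ultimately show "\<exists>z. ((\<lambda>t. u t + 2 * c * ln t) has_real_derivative z) (at y) \<and> z \<le> 0"
        by (intro exI[of _ "- 2 * v y + 2 * c / y"] conjI)
          (auto intro!: derivative_eq_intros du simp: field_simps)
    qed
    \<comment> \<open>The second argument makes the upper bound for \<open>u t\<close> given by \<open>dec\<close> nonpositive.\<close>
    define t where "t = max b (exp ((u b + 2 * c * ln b) / (2 * c)))"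
    have "exp ((u b + 2 * c * ln b) / (2 * c)) \<le> t" by (simp add: t_def)
    then have "(u b + 2 * c * ln b) / (2 * c) \<le> ln t"
      by (metis exp_gt_zero ln_exp ln_mono less_le_trans)
    then have "u b + 2 * c * ln b \<le> 2 * c * ln t" using c by (simp add: field_simps)
    moreover have "b \<le> t" by (simp add: t_def)
    ultimately show False using dec[of t] pos[of t] b by simp
  qed
  have u_mono: "u a \<le> u t" if "a \<le> t" for t
  proof (rule DERIV_nonneg_imp_nondecreasing[OF that])
    fix y assume "a \<le> y"
    then show "\<exists>z. (u has_real_derivative z) (at y) \<and> 0 \<le> z"
      using du[of y] v_le[of y] \<open>a > 0\<close> by (intro exI[of _ "- 2 * v y"]) auto
  qed
  have ge: "a * v a - u a * a\<^sup>2 \<le> t * v t - u a * t\<^sup>2" if "a \<le> t" for t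
  proof (rule DERIV_nonneg_imp_nondecreasing[OF that])
    fix y assume y: "a \<le> y"
    have "((\<lambda>t. u a * t\<^sup>2) has_real_derivative u a * (2 * y)) (at y)"
      by (auto intro!: derivative_eq_intros)
    then have "((\<lambda>t. t * v t - u a * t\<^sup>2) has_real_derivative 2 * y * u y - u a * (2 * y)) (at y)"
      using y \<open>a > 0\<close> by (intro DERIV_diff dw) auto
    moreover have "0 \<le> 2 * y * (u y - u a)"
      using u_mono[OF y] y \<open>a > 0\<close> by simp
    ultimately show "\<exists>z. ((\<lambda>t. t * v t - u a * t\<^sup>2) has_real_derivative z) (at y) \<and> 0 \<le> z"
      by (intro exI[of _ "2 * y * u y - u a * (2 * y)"]) (simp add: algebra_simps)
  qed
  define c where "c = \<bar>a * v a - u a * a\<^sup>2\<bar> / u a"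
  define t where "t = max a (max 1 (c + 1))"
  have ua: "u a > 0" using pos by simp
  have t: "t \<ge> a" "t \<ge> 1" "t > c" by (auto simp: t_def)
  have "t \<le> t * t" using t by simp
  with t have "c < t\<^sup>2" unfolding power2_eq_square by linarith
  then have "\<bar>a * v a - u a * a\<^sup>2\<bar> < u a * t\<^sup>2"
    using ua by (simp add: c_def field_simps)
  moreover have "t * v t \<le> 0" using v_le[of t] t by (simp add: mult_le_0_iff)
  ultimately show False using ge[of t] t by linarith
qed

lemma infinitely_many_zeros:
  fixes u v :: "real \<Rightarrow> real"
  assumes du: "\<And>t. t > 0 \<Longrightarrow> (u has_real_derivative - 2 * v t) (at t)"
    and dv: "\<And>t. t > 0 \<Longrightarrow> (v has_real_derivative 2 * u t - v t / t) (at t)"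
    and "a > 0"
  shows "\<exists>t\<ge>a. u t = 0"
proof (rule ccontr)
  assume "\<not> (\<exists>t\<ge>a. u t = 0)"
  then have nz: "u t \<noteq> 0" if "t \<ge> a" for t using that by blast
  have cont: "continuous_on {a..t} u" for t
    using \<open>a > 0\<close> by (intro continuous_at_imp_continuous_on) (auto intro: DERIV_isCont[OF du])
  show False
  proof (cases "u a > 0")
    case True
    have "u t > 0" if "t \<ge> a" for t
    proof (rule ccontr)
      assume "\<not> u t > 0"
      then have "\<exists>s\<ge>a. s \<le> t \<and> u s = 0"
        using True that by (intro IVT2') (auto intro: cont)
      then show False using nz by auto
    qed
    then show False using no_positive_solution[of u v a] assms by blast
  next
    case False
    then have ua: "u a < 0" using nz[of a] by simp
    have "- u t > 0" if "t \<ge> a" for t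
    proof (rule ccontr)
      assume "\<not> - u t > 0"
      then have "\<exists>s\<ge>a. s \<le> t \<and> u s = 0"
        using ua that by (intro IVT') (auto intro: cont)
      then show False using nz by auto
    qed
    moreover have "((\<lambda>t. - u t) has_real_derivative - 2 * (- v t)) (at t)" if "t > 0" for t
      using that by (auto intro!: derivative_eq_intros du)
    moreover have "((\<lambda>t. - v t) has_real_derivative 2 * (- u t) - (- v t) / t) (at t)" if "t > 0" for t
      using that by (auto intro!: derivative_eq_intros dv)
    ultimately show False
      using no_positive_solution[of "\<lambda>t. - u t" "\<lambda>t. - v t" a] \<open>a > 0\<close> by blast
  qed
qed

text \<open>
  The quantity \<open>t\<^sup>2 (u\<^sup>2 + v\<^sup>2)\<close> has derivative \<open>2 t u\<^sup>2 \<ge> 0\<close>. If it is zero at \<open>b\<close>, it is zero on all of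
  \<open>(0, b]\<close>, and \<open>u 0 = 0\<close> follows by continuity; for \<open>J\<^sub>0\<close> this is absurd.
\<close>

lemma no_common_zero:
  fixes u v :: "real \<Rightarrow> real"
  assumes du: "\<And>t. t > 0 \<Longrightarrow> (u has_real_derivative - 2 * v t) (at t)"
    and dv: "\<And>t. t > 0 \<Longrightarrow> (v has_real_derivative 2 * u t - v t / t) (at t)"
    and "b > 0" and zero: "u b = 0" "v b = 0"
    and cont: "isCont u 0"
  shows "u 0 = 0"
proof -
  have "u s = 0" if s: "0 < s" "s \<le> b" for s
  proof -
    have "s\<^sup>2 * ((u s)\<^sup>2 + (v s)\<^sup>2) \<le> b\<^sup>2 * ((u b)\<^sup>2 + (v b)\<^sup>2)"
    proof (rule DERIV_nonneg_imp_nondecreasing[OF s(2)])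
      fix y assume "s \<le> y"
      then have y: "y > 0" using s by simp
      show "\<exists>z. ((\<lambda>t. t\<^sup>2 * ((u t)\<^sup>2 + (v t)\<^sup>2)) has_real_derivative z) (at y) \<and> 0 \<le> z"
        using y by (intro exI[of _ "2 * y * (u y)\<^sup>2"] conjI)
          (auto intro!: derivative_eq_intros du dv simp: field_simps power2_eq_square)
    qed
    also have "\<dots> = 0" using zero by simp
    finally have "(u s)\<^sup>2 + (v s)\<^sup>2 \<le> 0"
      using s by (simp add: mult_le_0_iff)
    then show ?thesis by (simp add: sum_power2_le_zero_iff)
  qed
  then have "eventually (\<lambda>s. u s = 0) (at_right 0)"
    using \<open>b > 0\<close> by (auto simp: eventually_at_right_field intro!: exI[of _ b])
  then have "(u \<longlongrightarrow> 0) (at_right 0)" by (rule tendsto_eventually)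
  moreover have "(u \<longlongrightarrow> u 0) (at_right 0)"
    using cont by (simp add: isCont_def filterlim_at_split)
  ultimately show ?thesis using tendsto_unique trivial_limit_at_right_real by blast
qed

text \<open>
  The bound \<open>1 / (m!)\<^sup>2 \<le> 2\<^sup>2\<^sup>m / (2m)!\<close> compares the series with that of \<open>exp (2 \<bar>\<tau>\<bar>)\<close>.
\<close>

lemma summable_bessel0: "summable (\<lambda>n. fps_nth bessel0 n * z ^ n)"
proof (rule summable_comparison_test')
  show "summable (\<lambda>n. inverse (fact n) * (2 * norm z) ^ n)"
    by (rule summable_exp)
  fix n assume "n \<ge> (0::nat)"
  show "norm (fps_nth bessel0 n * z ^ n) \<le> inverse (fact n) * (2 * norm z) ^ n"
  proof (cases "even n")
    case True
    then obtain m where n: "n = 2 * m" by (auto elim: evenE)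
    have "(2 * m) choose m \<le> 2 ^ (2 * m)"
      by (rule binomial_le_pow2)
    then have "real ((2 * m) choose m) \<le> 2 ^ (2 * m)"
      by (metis of_nat_le_iff of_nat_numeral of_nat_power)
    then have "1 / (fact m)\<^sup>2 \<le> (2 ^ (2 * m) / fact (2 * m) :: real)"
      by (simp add: binomial_fact field_simps power2_eq_square)
    then have "1 / (fact m)\<^sup>2 * norm z ^ (2 * m) \<le> 2 ^ (2 * m) / fact (2 * m) * norm z ^ (2 * m)"
      by (rule mult_right_mono) simp
    then show ?thesis
      by (simp add: n bessel0_nth norm_mult norm_divide norm_power power_mult_distrib field_simps)
  qed (simp add: bessel0_nth)
qed

lemma conv_radius_bessel0 [simp]: "fps_conv_radius bessel0 = \<infinity>"
  unfolding fps_conv_radius_def by (rule conv_radius_inftyI'') (rule summable_bessel0)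

lemma conv_radius_bessel1 [simp]: "fps_conv_radius bessel1 = \<infinity>"
  using fps_conv_radius_deriv[of bessel0]
  by (simp add: bessel1_def fps_conv_radius_cmult_left)

lemma conv_radius_deriv_bessel1 [simp]: "fps_conv_radius (fps_deriv bessel1) = \<infinity>"
  using fps_conv_radius_deriv[of bessel1] by simp

lemma eval_deriv_bessel0: "eval_fps (fps_deriv bessel0) z = 2 * eval_fps bessel1 z"
proof -
  have "fps_deriv bessel0 = fps_const 2 * bessel1"
    by (simp add: bessel1_def fps_eq_iff)
  then show ?thesis by (simp add: eval_fps_mult)
qed

lemma eval_deriv_bessel1:
  "z * eval_fps (fps_deriv bessel1) z = 2 * (z * eval_fps bessel0 z) - eval_fps bessel1 z"
proof -
  have "fps_X * fps_deriv bessel1 = fps_const 2 * theta bessel1"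
    by (simp add: theta_def fps_eq_iff)
  also have "\<dots> = fps_const 2 * (fps_X * bessel0) - bessel1"
    unfolding theta_bessel1 by (simp add: fps_eq_iff)
  finally have "eval_fps (fps_X * fps_deriv bessel1) z =
      eval_fps (fps_const 2 * (fps_X * bessel0) - bessel1) z" by simp
  moreover have "fps_conv_radius (fps_X * bessel0) = \<infinity>"
    using fps_conv_radius_mult[of fps_X bessel0] by simp
  moreover have "fps_conv_radius (fps_const 2 * (fps_X * bessel0)) = \<infinity>"
    using fps_conv_radius_mult[of "fps_const 2" "fps_X * bessel0"] calculation by simp
  ultimately show ?thesis by (simp add: eval_fps_mult eval_fps_diff)
qed

text \<open>
  Only even powers occur, so \<open>f\<close> is real on the imaginary axis, and a zero of its real part there
  is a zero of \<open>f\<close>.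
\<close>

lemma eval_bessel0_imag_axis: "Im (eval_fps bessel0 (\<i> * of_real t)) = 0"
proof -
  have "Im (fps_nth bessel0 n * (\<i> * of_real t) ^ n) = 0" for n
  proof (cases "even n")
    case True
    then obtain m where n: "n = 2 * m" by (auto elim: evenE)
    have "(\<i> * of_real t) ^ n = of_real ((- (t\<^sup>2)) ^ m)"
      by (simp add: n power_mult power_mult_distrib)
    moreover have "fps_nth bessel0 n = of_real (1 / (fact m)\<^sup>2)"
      by (simp add: bessel0_nth n)
    ultimately show ?thesis by (metis Im_complex_of_real of_real_mult)
  qed (simp add: bessel0_nth)
  then show ?thesis
    unfolding eval_fps_def
    using bounded_linear.suminf[OF bounded_linear_Im summable_bessel0, of "\<i> * of_real t"] by simp
qed

text \<open>
  On the imaginary axis \<open>\<tau> = \<i>t\<close> the functions \<open>u = Re f\<close> and \<open>v = Im h\<close> satisfy the real system of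
  the preceding lemmas, since \<open>I\<^sub>0(2\<i>t) = J\<^sub>0(2t)\<close> and \<open>I\<^sub>1(2\<i>t) = \<i> J\<^sub>1(2t)\<close>.
\<close>

lemma bessel0_zeros: "infinite {z. eval_fps bessel0 z = 0 \<and> eval_fps bessel1 z \<noteq> 0}"
proof -
  define u where "u t = Re (eval_fps bessel0 (\<i> * of_real t))" for t
  define v where "v t = Im (eval_fps bessel1 (\<i> * of_real t))" for t
  have der: "((\<lambda>t. eval_fps F (\<i> * of_real t)) has_vector_derivative
      \<i> * eval_fps (fps_deriv F) (\<i> * of_real t)) (at t)"
    if "fps_conv_radius F = \<infinity>" for F t
  proof -
    have "((\<lambda>t. \<i> * of_real t) has_vector_derivative \<i>) (at t)"
      by (auto intro!: derivative_eq_intros)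
    moreover have "(eval_fps F has_field_derivative eval_fps (fps_deriv F) (\<i> * of_real t)) (at (\<i> * of_real t))"
      by (rule has_field_derivative_eval_fps) (simp add: that)
    ultimately show ?thesis
      using field_vector_diff_chain_at by (fastforce simp: o_def)
  qed
  have du: "(u has_real_derivative - 2 * v t) (at t)" for t
    using bounded_linear.has_vector_derivative[OF bounded_linear_Re der[of bessel0 t]]
    by (simp add: u_def[abs_def] v_def eval_deriv_bessel0 has_real_derivative_iff_has_vector_derivative)
  have dv: "(v has_real_derivative 2 * u t - v t / t) (at t)" if "t > 0" for t
  proof -
    have "t * Re (eval_fps (fps_deriv bessel1) (\<i> * of_real t)) = 2 * (t * u t) - v t"
      using arg_cong[OF eval_deriv_bessel1[of "\<i> * of_real t"], of Im] by (simp add: u_def v_def)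
    then have "Re (eval_fps (fps_deriv bessel1) (\<i> * of_real t)) = 2 * u t - v t / t"
      using that by (simp add: field_simps)
    then show ?thesis
      using bounded_linear.has_vector_derivative[OF bounded_linear_Im der[of bessel1 t]]
      by (simp add: v_def[abs_def] has_real_derivative_iff_has_vector_derivative)
  qed
  have u0: "u 0 = 1" by (simp add: u_def eval_fps_at_0 bessel0_nth)
  have zero: "\<exists>t\<ge>a. t > 0 \<and> u t = 0 \<and> v t \<noteq> 0" for a
  proof -
    obtain t where t: "t \<ge> max a 1" "u t = 0"
      using infinitely_many_zeros[of u v "max a 1"] du dv by (auto simp: less_max_iff_disj)
    moreover have "v t \<noteq> 0"
      using no_common_zero[of u v t] du dv t u0 DERIV_isCont[OF du] by auto
    ultimately show ?thesis by (intro exI[of _ t]) auto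
  qed
  let ?T = "{t. u t = 0 \<and> v t \<noteq> 0}"
  have "infinite ?T"
  proof
    assume "finite ?T"
    then obtain M where "\<And>t. t \<in> ?T \<Longrightarrow> t \<le> M"
      using bdd_above_finite[of ?T] by (auto simp: bdd_above_def)
    then show False using zero[of "M + 1"] by force
  qed
  moreover have "inj_on (\<lambda>t. \<i> * of_real t :: complex) ?T" by (auto simp: inj_on_def)
  ultimately have "infinite ((\<lambda>t. \<i> * of_real t :: complex) ` ?T)"
    by (simp add: finite_image_iff)
  moreover have "(\<lambda>t. \<i> * of_real t) ` ?T \<subseteq> {z. eval_fps bessel0 z = 0 \<and> eval_fps bessel1 z \<noteq> 0}"
    by (auto simp: u_def v_def complex_eq_iff eval_bessel0_imag_axis)
  ultimately show ?thesis using infinite_super by blast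
qed

text \<open>
  At a zero of \<open>f\<close> where \<open>h\<close> does not vanish only the term with \<open>k = m\<close> survives, so \<open>p m\<close> has
  infinitely many roots. With \<open>p m = 0\<close> the relation is divisible by \<open>f\<close>, which lowers \<open>m\<close>.
\<close>

lemma bessel_forms_independent:
  assumes "(\<Sum>k\<le>m. fps_of_poly (p k) * bessel0 ^ (m - k) * bessel1 ^ k) = 0" "k \<le> m"
  shows "p k = 0"
  using assms
proof (induction m arbitrary: k)
  case 0
  then show ?case using fps_of_poly_eq_iff[of "p 0" 0] by simp
next
  case (Suc m)
  let ?S = "\<lambda>n. (\<Sum>k\<le>n. fps_of_poly (p k) * bessel0 ^ (n - k) * bessel1 ^ k)"
  have split: "?S (Suc m) = bessel0 * ?S m + fps_of_poly (p (Suc m)) * bessel1 ^ Suc m"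
    by (auto simp: sum_distrib_left Suc_diff_le mult_ac intro!: sum.cong)
  have "poly (p (Suc m)) z = 0" if z: "eval_fps bessel0 z = 0" "eval_fps bessel1 z \<noteq> 0" for z
  proof -
    have rad: "fps_conv_radius (F * H) = \<infinity>"
      if "fps_conv_radius F = \<infinity>" "fps_conv_radius H = \<infinity>" for F H :: "complex fps"
      using fps_conv_radius_mult[of F H] that by simp
    have radp: "fps_conv_radius (F ^ n) = \<infinity>" if "fps_conv_radius F = \<infinity>" for F :: "complex fps" and n
      using fps_conv_radius_power[of F n] that by simp
    have rads: "fps_conv_radius (sum F A) = \<infinity>"
      if "\<And>i. fps_conv_radius (F i) = \<infinity>" for F :: "nat \<Rightarrow> complex fps" and A
    proof (induction A rule: infinite_finite_induct)
      case (insert x A)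
      then show ?case using fps_conv_radius_add[of "F x" "sum F A"] that by simp
    qed auto
    have radS: "fps_conv_radius (?S m) = \<infinity>" by (intro rads rad radp) simp_all
    have "0 = eval_fps (?S (Suc m)) z" using Suc.prems by simp
    also have "\<dots> = eval_fps bessel0 z * eval_fps (?S m) z +
        poly (p (Suc m)) z * eval_fps bessel1 z ^ Suc m"
      unfolding split
      by (simp add: eval_fps_add eval_fps_mult eval_fps_power rad radp radS del: power_Suc)
    finally show ?thesis using z by simp
  qed
  then have "infinite {z. poly (p (Suc m)) z = 0}"
    using bessel0_zeros by (elim contrapos_nn) (auto elim: finite_subset[rotated])
  then have top: "p (Suc m) = 0" using poly_roots_finite by blast
  have "bessel0 \<noteq> 0" by (auto simp: fps_eq_iff bessel0_nth)
  then have "?S m = 0" using split Suc.prems(1) top by simp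
  then show ?case using Suc.IH[of k] Suc.prems(2) top by (cases "k = Suc m") auto
qed

section \<open>Minimality: comparison of top-degree terms\<close>

text \<open>
  Writing a form of degree \<open>d\<close> in \<open>f, h\<close> as \<open>f\<^sup>d P(h/f)\<close>, the derivation \<open>f \<mapsto> h\<close>, \<open>h \<mapsto> f\<close> becomes
  \<open>P \<mapsto> d w P + (1 - w\<^sup>2) P'\<close>. The polynomials \<open>lead_poly d i\<close> are its iterates on \<open>f\<^sup>d\<close>; they describe
  the terms of \<open>\<theta>\<^sup>i f\<^sup>d\<close> that have the top degree \<open>i\<close> in \<open>\<tau>\<close>.
\<close>

fun lead_poly :: "nat \<Rightarrow> nat \<Rightarrow> complex poly" where
  "lead_poly d 0 = 1"
| "lead_poly d (Suc i) = smult (of_nat d) ([:0, 1:] * lead_poly d i) + [:1, 0, -1:] * pderiv (lead_poly d i)"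

text \<open>
  \<open>form_coeff d i k\<close> is the coefficient, a polynomial in \<open>\<tau>\<close>, of \<open>f\<^sup>d\<^sup>-\<^sup>k h\<^sup>k\<close> in \<open>\<theta>\<^sup>i f\<^sup>d\<close>.
\<close>

fun form_coeff :: "nat \<Rightarrow> nat \<Rightarrow> nat \<Rightarrow> complex poly" where
  "form_coeff d 0 k = (if k = 0 then 1 else 0)"
| "form_coeff d (Suc i) k =
     smult (1/2) ([:0, 1:] * pderiv (form_coeff d i k)) - smult (of_nat k / 2) (form_coeff d i k) +
     [:0, 1:] * ((if k = 0 then 0 else smult (of_nat (Suc d - k)) (form_coeff d i (k - 1))) +
                 smult (of_nat (Suc k)) (form_coeff d i (Suc k)))"

lemma form_coeff_eq_0: "d < k \<Longrightarrow> form_coeff d i k = 0"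
proof (induction i arbitrary: k)
  case (Suc i)
  show ?case
  proof (cases "k = Suc d")
    case False
    then show ?thesis using Suc by simp
  qed (use Suc in simp)
qed simp

lemma theta_form:
  assumes "k \<le> d"
  shows "theta (bessel0 ^ (d - k) * bessel1 ^ k) =
    fps_X * (of_nat (Suc d - Suc k) * (bessel0 ^ (d - Suc k) * bessel1 ^ Suc k)) +
    fps_X * (of_nat k * (bessel0 ^ (d - (k - 1)) * bessel1 ^ (k - 1))) -
    fps_const (of_nat k / 2) * (bessel0 ^ (d - k) * bessel1 ^ k)"
proof (cases k)
  case 0
  then show ?thesis
    by (simp add: theta_power theta_bessel0 mult_ac del: of_nat_diff)
next
  case (Suc l)
  then have e: "bessel0 ^ (d - l) = bessel0 * bessel0 ^ (d - k)"
    using assms by (simp flip: power_Suc add: Suc_diff_Suc)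
  have c: "fps_const (of_nat k / 2) = of_nat k * fps_const (1/2 :: complex)"
    by (simp flip: fps_of_nat)
  show ?thesis
    unfolding theta_mult[of "bessel0 ^ (d - k)"] theta_power theta_bessel0 theta_bessel1 c
    using Suc e by (simp add: algebra_simps del: of_nat_diff of_nat_Suc)
qed

lemma sum_shift:
  fixes g :: "nat \<Rightarrow> 'a :: comm_monoid_add"
  assumes "g 0 = 0" "g (Suc d) = 0"
  shows "(\<Sum>k\<le>d. g (Suc k)) = (\<Sum>k\<le>d. g k)"
  using sum.atMost_Suc_shift[of g d] sum.atMost_Suc[of g d] assms by simp

lemma theta_fps_of_poly: "theta (fps_of_poly p) = fps_of_poly (smult (1/2) ([:0, 1:] * pderiv p))"
  by (simp add: theta_def fps_of_poly_smult fps_of_poly_pCons fps_of_poly_pderiv mult.commute)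

lemma theta_funpow_bessel0_power:
  "(theta ^^ i) (bessel0 ^ d) =
     (\<Sum>k\<le>d. fps_of_poly (form_coeff d i k) * (bessel0 ^ (d - k) * bessel1 ^ k))"
proof (induction i)
  case 0
  have "(\<Sum>k\<le>d. fps_of_poly (form_coeff d 0 k) * (bessel0 ^ (d - k) * bessel1 ^ k)) =
     (\<Sum>k\<in>{0}. bessel0 ^ (d - k) * bessel1 ^ k)"
    by (rule sum.mono_neutral_cong_right) auto
  then show ?case by simp
next
  case (Suc i)
  let ?b = "\<lambda>k. fps_of_poly (form_coeff d i k)"
  let ?M = "\<lambda>k. bessel0 ^ (d - k) * bessel1 ^ k"
  let ?up = "\<lambda>k. if k = 0 then 0 else of_nat (Suc d - k) * ?b (k - 1) * ?M k"
  let ?down = "\<lambda>k. of_nat k * ?b k * ?M (k - 1)"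
  have up: "(\<Sum>k\<le>d. of_nat (Suc d - Suc k) * ?b k * ?M (Suc k)) = (\<Sum>k\<le>d. ?up k)"
    using sum_shift[of ?up d] by simp
  have down: "(\<Sum>k\<le>d. of_nat (Suc k) * ?b (Suc k) * ?M k) = (\<Sum>k\<le>d. ?down k)"
    using sum_shift[of ?down d] by (simp add: form_coeff_eq_0)
  have "(theta ^^ Suc i) (bessel0 ^ d) = (\<Sum>k\<le>d. theta (?b k) * ?M k + ?b k * theta (?M k))"
    by (simp add: Suc.IH theta_sum theta_mult[of "?b _" "?M _"])
  also have "\<dots> = (\<Sum>k\<le>d. theta (?b k) * ?M k - fps_const (of_nat k / 2) * ?b k * ?M k +
      fps_X * (of_nat (Suc d - Suc k) * ?b k * ?M (Suc k)) + fps_X * ?down k)"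
    by (intro sum.cong refl, subst theta_form) (auto simp: algebra_simps simp del: of_nat_diff)
  also have "\<dots> = (\<Sum>k\<le>d. theta (?b k) * ?M k - fps_const (of_nat k / 2) * ?b k * ?M k) +
      fps_X * (\<Sum>k\<le>d. of_nat (Suc d - Suc k) * ?b k * ?M (Suc k)) + fps_X * (\<Sum>k\<le>d. ?down k)"
    by (simp only: sum.distrib sum_distrib_left)
  also have "\<dots> = (\<Sum>k\<le>d. theta (?b k) * ?M k - fps_const (of_nat k / 2) * ?b k * ?M k +
      fps_X * ?up k + fps_X * (of_nat (Suc k) * ?b (Suc k) * ?M k))"
    unfolding up down[symmetric] by (simp only: sum.distrib sum_distrib_left)
  also have "\<dots> = (\<Sum>k\<le>d. fps_of_poly (form_coeff d (Suc i) k) * ?M k)"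
  proof (intro sum.cong refl)
    fix k
    have X: "fps_of_poly ([:0, 1:] * p) = fps_X * fps_of_poly p" for p :: "complex poly"
      by (simp add: fps_of_poly_pCons)
    have n: "fps_of_poly (smult (of_nat m) p) = of_nat m * fps_of_poly p" for m and p :: "complex poly"
      by (simp add: fps_of_poly_smult fps_of_nat)
    have eq: "fps_of_poly (form_coeff d (Suc i) k) = theta (?b k) - fps_const (of_nat k / 2) * ?b k +
      fps_X * ((if k = 0 then 0 else of_nat (Suc d - k) * ?b (k - 1)) + of_nat (Suc k) * ?b (Suc k))"
      unfolding form_coeff.simps fps_of_poly_add fps_of_poly_diff X theta_fps_of_poly[symmetric] n
        fps_of_poly_smult[of "of_nat k / 2"]
      by (simp add: n del: of_nat_Suc of_nat_diff)
    show "theta (?b k) * ?M k - fps_const (of_nat k / 2) * ?b k * ?M k +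
      fps_X * ?up k + fps_X * (of_nat (Suc k) * ?b (Suc k) * ?M k) =
      fps_of_poly (form_coeff d (Suc i) k) * ?M k"
      unfolding eq by (simp add: algebra_simps del: of_nat_Suc of_nat_diff form_coeff.simps)
  qed
  finally show ?case .
qed

lemma coeff_X_mult: "coeff ([:0, 1:] * p) (Suc n) = coeff p n" for p :: "complex poly"
  by simp

text \<open>
  Only the multiplications by \<open>\<tau>\<close> raise the degree, by one in each step, and they act by the
  derivation that defines \<open>lead_poly\<close>. The two sides are graded differently: \<open>coeff\<close> on the left
  extracts a power of \<open>\<tau>\<close>, on the right a power of \<open>w = h/f\<close>.
\<close>

lemma form_coeff_lead:
  "coeff (form_coeff d i k) i = coeff (lead_poly d i) k \<and> (\<forall>n>i. coeff (form_coeff d i k) n = 0)"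
proof (induction i arbitrary: k)
  case 0
  show ?case by (auto simp: coeff_eq_0)
next
  case (Suc i)
  then have lead: "coeff (lead_poly d i) k = coeff (form_coeff d i k) i"
    and zero: "n > i \<Longrightarrow> coeff (form_coeff d i k) n = 0" for k n by auto
  have "coeff (form_coeff d (Suc i) k) (Suc i) =
     (if k = 0 then 0 else of_nat (Suc d - k) * coeff (lead_poly d i) (k - 1)) +
     of_nat (Suc k) * coeff (lead_poly d i) (Suc k)"
    unfolding form_coeff.simps coeff_add coeff_diff coeff_smult coeff_X_mult coeff_pderiv
    by (simp add: zero lead)
  also have "\<dots> = coeff (lead_poly d (Suc i)) k"
  proof (cases k)
    case (Suc m)
    have "of_nat (d - m) * coeff (lead_poly d i) m = (of_nat d - of_nat m) * coeff (lead_poly d i) m"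
      by (cases "m \<le> d") (simp_all add: lead form_coeff_eq_0)
    then show ?thesis using Suc
      by (cases m) (simp_all add: coeff_pderiv coeff_pCons algebra_simps del: of_nat_diff)
  qed (simp add: coeff_pderiv)
  finally have "coeff (form_coeff d (Suc i) k) (Suc i) = coeff (lead_poly d (Suc i)) k" .
  moreover have "coeff (form_coeff d (Suc i) k) n = 0" if n: "n > Suc i" for n
  proof -
    obtain m where m: "n = Suc m" using n by (cases n) auto
    show ?thesis
      unfolding m form_coeff.simps coeff_add coeff_diff coeff_smult coeff_X_mult coeff_pderiv
      using n m by (simp add: zero)
  qed
  ultimately show ?case by blast
qed

lemma smult_sum_right: "smult c (sum f A) = (\<Sum>a\<in>A. smult c (f a))"
  by (rule poly_eqI) (simp add: coeff_sum sum_distrib_left)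

text \<open>
  The products \<open>(1 + w)\<^sup>m (1 - w)\<^sup>d\<^sup>-\<^sup>m\<close> are eigenvectors of \<open>P \<mapsto> d w P + (1 - w\<^sup>2) P'\<close> with eigenvalue
  \<open>2m - d\<close>, and \<open>2\<^sup>d = ((1 + w) + (1 - w))\<^sup>d\<close> is a combination of them by the binomial theorem.
\<close>

lemma lead_poly_closed_form:
  "smult (2 ^ d) (lead_poly d i) =
     (\<Sum>m\<le>d. smult (of_nat (d choose m) * (2 * of_nat m - of_nat d) ^ i) ([:1, 1:] ^ m * [:1, -1:] ^ (d - m)))"
proof (induction i)
  case 0
  have "[:1, 1:] + [:1, -1:] = [:2 :: complex:]" by simp
  then have "[:2 :: complex:] ^ d = (\<Sum>m\<le>d. of_nat (d choose m) * [:1, 1:] ^ m * [:1, -1:] ^ (d - m))"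
    using binomial_ring[of "[:1, 1 :: complex:]" "[:1, -1:]" d] by simp
  moreover have "[:2 :: complex:] ^ d = smult (2 ^ d) 1"
    by (induction d) simp_all
  ultimately show ?case by (simp add: of_nat_poly mult.assoc)
next
  case (Suc i)
  define D where "D p = smult (of_nat d) ([:0, 1:] * p) + [:1, 0, -1:] * pderiv p" for p :: "complex poly"
  let ?e = "\<lambda>m. [:1, 1 :: complex:] ^ m * [:1, -1:] ^ (d - m)"
  have D_smult: "D (smult c p) = smult c (D p)" for c p
    by (simp add: D_def pderiv_smult smult_add_right mult.commute)
  have D_add: "D (p + q) = D p + D q" for p q
    by (simp only: D_def pderiv_add smult_add_right distrib_left add_ac)
  have D_sum: "D (sum f A) = (\<Sum>a\<in>A. D (f a))" for f :: "nat \<Rightarrow> complex poly" and A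
    by (induction A rule: infinite_finite_induct) (simp_all add: D_add, simp_all add: D_def)
  have D_e: "D (?e m) = smult (2 * of_nat m - of_nat d) (?e m)" if "m \<le> d" for m
  proof -
    let ?a = "[:1, 1 :: complex:]" and ?b = "[:1, -1 :: complex:]"
    have ab: "[:1, 0, -1 :: complex:] = ?a * ?b" by simp
    have pow: "p * pderiv (p ^ n) = smult (of_nat n) (p ^ n * pderiv p)" for p :: "complex poly" and n
      unfolding pderiv_power by (cases n) (simp_all add: mult_ac)
    have da: "pderiv ?a = 1" and db: "pderiv ?b = -1"
      by (simp_all add: pderiv_pCons one_pCons)
    have gen: "(B * Q) * smult x (P * 1) + (A * P) * smult y (Q * - 1) = (smult x B - smult y A) * (P * Q)"
      for A B P Q :: "complex poly" and x y
      by (simp add: algebra_simps)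
    have "[:1, 0, -1:] * pderiv (?e m) = (?b * ?b ^ (d - m)) * (?a * pderiv (?a ^ m)) +
        (?a * ?a ^ m) * (?b * pderiv (?b ^ (d - m)))"
      unfolding ab pderiv_mult by (simp only: algebra_simps)
    also have "\<dots> = (smult (of_nat m) ?b - smult (of_nat (d - m)) ?a) * ?e m"
      unfolding pow da db by (rule gen)
    finally have dE: "[:1, 0, -1:] * pderiv (?e m) = (smult (of_nat m) ?b - smult (of_nat (d - m)) ?a) * ?e m" .
    have gen': "smult x (A * E) + (B - C) * E = (smult x A + B - C) * E" for A B C E :: "complex poly" and x
      by (simp add: algebra_simps)
    have "D (?e m) = (smult (of_nat d) [:0, 1:] + smult (of_nat m) ?b - smult (of_nat (d - m)) ?a) * ?e m"
      unfolding D_def dE by (rule gen')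
    also have "smult (of_nat d) [:0, 1:] + smult (of_nat m) ?b - smult (of_nat (d - m)) ?a = [:2 * of_nat m - of_nat d:]"
      using that by (simp add: of_nat_diff)
    finally show ?thesis by simp
  qed
  have "smult (2 ^ d) (lead_poly d (Suc i)) = D (smult (2 ^ d) (lead_poly d i))"
    unfolding D_smult by (simp add: D_def)
  also have "\<dots> = (\<Sum>m\<le>d. smult (of_nat (d choose m) * (2 * of_nat m - of_nat d) ^ i) (D (?e m)))"
    by (simp only: Suc.IH D_sum D_smult)
  also have "\<dots> = (\<Sum>m\<le>d. smult (of_nat (d choose m) * (2 * of_nat m - of_nat d) ^ Suc i) (?e m))"
    by (intro sum.cong refl) (simp add: D_e mult_ac)
  finally show ?case .
qed

text \<open>
  The substitution \<open>w = (y - 1) / (y + 1)\<close> turns \<open>(1 + w)\<^sup>m (1 - w)\<^sup>d\<^sup>-\<^sup>m\<close> into \<open>y\<^sup>m\<close>, up to the common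
  factor \<open>(2 / (y + 1))\<^sup>d\<close>.
\<close>

lemma eigencomponents_independent:
  fixes q :: "nat \<Rightarrow> complex"
  assumes "(\<Sum>m\<le>d. smult (q m) ([:1, 1:] ^ m * [:1, -1:] ^ (d - m))) = 0" "m \<le> d"
  shows "q m = 0"
proof -
  let ?Q = "\<Sum>m\<le>d. monom (q m) m"
  have "poly ?Q y = 0" if y: "y \<noteq> -1" for y
  proof -
    have y1: "y + 1 \<noteq> 0" using y by (metis add.commute add_eq_0_iff)
    define w where "w = (y - 1) / (y + 1)"
    have w: "1 + w = y * (2 / (y + 1))" "1 - w = 2 / (y + 1)"
      using y1 by (simp_all add: w_def field_simps)
    have "0 = (\<Sum>m\<le>d. q m * ((1 + w) ^ m * (1 - w) ^ (d - m)))"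
      using arg_cong[OF assms(1), of "\<lambda>p. poly p w"] by (simp add: poly_sum)
    also have "\<dots> = (\<Sum>m\<le>d. (2 / (y + 1)) ^ d * (q m * y ^ m))"
    proof (intro sum.cong refl)
      fix m assume "m \<in> {..d}"
      then have "(2 / (y + 1)) ^ d = (2 / (y + 1)) ^ m * (2 / (y + 1)) ^ (d - m)"
        by (simp flip: power_add)
      then show "q m * ((1 + w) ^ m * (1 - w) ^ (d - m)) = (2 / (y + 1)) ^ d * (q m * y ^ m)"
        unfolding w by (simp only: power_mult_distrib) (simp only: mult_ac)
    qed
    also have "\<dots> = (2 / (y + 1)) ^ d * poly ?Q y"
      by (simp add: poly_sum poly_monom sum_distrib_left)
    finally show ?thesis using y1 by simp
  qed
  then have "- {-1} \<subseteq> {y. poly ?Q y = 0}" by auto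
  moreover have "infinite (- {-1 :: complex})"
    by (simp add: infinite_UNIV_char_0 Compl_eq_Diff_UNIV)
  ultimately have "?Q = 0" using poly_roots_finite finite_subset by blast
  then have "coeff ?Q m = 0" by simp
  then show ?thesis using assms(2) by (simp add: coeff_sum)
qed

text \<open>
  Comparing eigencomponents gives \<open>\<Sum>\<^sub>j C\<^sub>j \<lambda>\<^sup>N\<^sup>-\<^sup>2\<^sup>j = 0\<close> for every eigenvalue \<open>\<lambda> = 2m - d\<close>. The values
  with \<open>m < (d + 1) div 2\<close> are negative, so their inverse squares are that many distinct roots of
  \<open>\<Sum>\<^sub>j C\<^sub>j y\<^sup>j\<close>, whose degree is at most \<open>s\<close>.
\<close>

lemma lead_poly_independent:
  fixes C :: "nat \<Rightarrow> complex"
  assumes s: "s < (d + 1) div 2" and C: "\<And>j. N < 2 * j \<Longrightarrow> C j = 0"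
    and zero: "(\<Sum>j\<le>s. smult (C j) (lead_poly d (N - 2 * j))) = 0" and "j \<le> s"
  shows "C j = 0"
proof -
  let ?l = "\<lambda>m. 2 * of_nat m - of_nat d :: complex"
  let ?q = "\<lambda>m. \<Sum>j\<le>s. C j * ?l m ^ (N - 2 * j)"
  have q0: "?q m = 0" if m: "m \<le> d" for m
  proof -
    have "(\<Sum>m\<le>d. smult (of_nat (d choose m) * ?q m) ([:1, 1:] ^ m * [:1, -1:] ^ (d - m))) =
      (\<Sum>m\<le>d. \<Sum>j\<le>s. smult (C j) (smult (of_nat (d choose m) * ?l m ^ (N - 2 * j)) ([:1, 1:] ^ m * [:1, -1:] ^ (d - m))))"
      by (simp only: sum_distrib_left smult_sum smult_smult mult_ac)
    also have "\<dots> = (\<Sum>j\<le>s. smult (C j) (smult (2 ^ d) (lead_poly d (N - 2 * j))))"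
      unfolding lead_poly_closed_form smult_sum_right by (rule sum.swap)
    also have "\<dots> = smult (2 ^ d) (\<Sum>j\<le>s. smult (C j) (lead_poly d (N - 2 * j)))"
      by (simp only: smult_sum_right smult_smult mult_ac)
    finally have "(\<Sum>m\<le>d. smult (of_nat (d choose m) * ?q m) ([:1, 1:] ^ m * [:1, -1:] ^ (d - m))) = 0"
      by (simp only: zero smult_0_right)
    then have "of_nat (d choose m) * ?q m = 0"
      using m by (rule eigencomponents_independent)
    moreover have "of_nat (d choose m) \<noteq> (0 :: complex)"
      using m by (simp add: binomial_eq_0_iff)
    ultimately show ?thesis by (metis mult_eq_0_iff)
  qed
  let ?S = "\<Sum>j\<le>s. monom (C j) j"
  let ?r = "(d + 1) div 2"
  let ?y = "\<lambda>m. inverse ((?l m)\<^sup>2)"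
  have neg: "?l m = - of_nat (d - 2 * m)" "d - 2 * m > 0" if "m < ?r" for m
    using that by (auto simp: of_nat_diff)
  have "poly ?S (?y m) = 0" if m: "m < ?r" for m
  proof -
    have nz: "?l m \<noteq> 0"
      unfolding neg(1)[OF m] using neg(2)[OF m] by (simp del: of_nat_diff)
    have "0 = ?q m" by (rule q0[symmetric]) (use m in simp)
    also have "\<dots> = (\<Sum>j\<le>s. ?l m ^ N * (C j * ?y m ^ j))"
    proof (intro sum.cong refl)
      fix j
      show "C j * ?l m ^ (N - 2 * j) = ?l m ^ N * (C j * ?y m ^ j)"
      proof (cases "N < 2 * j")
        case False
        then have "?l m ^ N = ?l m ^ (N - 2 * j) * (?l m)\<^sup>2 ^ j"
          by (simp only: power_mult[symmetric] power_add[symmetric]) simp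
        then show ?thesis using nz by (simp add: power_inverse)
      qed (simp add: C)
    qed
    also have "\<dots> = ?l m ^ N * poly ?S (?y m)"
      by (simp add: poly_sum poly_monom sum_distrib_left)
    finally have "?l m ^ N * poly ?S (?y m) = 0" by (rule sym)
    then show ?thesis using nz power_not_zero mult_eq_0_iff by blast
  qed
  then have sub: "?y ` {..<?r} \<subseteq> {z. poly ?S z = 0}"
    by (intro image_subsetI CollectI) (simp only: lessThan_iff)
  have "inj_on ?y {..<?r}"
  proof (rule inj_onI)
    fix m n assume mn: "m \<in> {..<?r}" "n \<in> {..<?r}" and eq: "?y m = ?y n"
    then have "(?l m)\<^sup>2 = (?l n)\<^sup>2" by (simp only: inverse_eq_iff_eq)
    then have "(of_nat (d - 2 * m) :: complex)\<^sup>2 = (of_nat (d - 2 * n))\<^sup>2"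
      using mn by (simp only: neg(1) lessThan_iff power2_minus)
    then have "(d - 2 * m)\<^sup>2 = (d - 2 * n)\<^sup>2" by (metis of_nat_eq_iff of_nat_power)
    then have "d - 2 * m = d - 2 * n" by simp
    then show "m = n" using mn neg(2)[of m] neg(2)[of n] by auto
  qed
  then have card: "card (?y ` {..<?r}) = ?r" by (simp add: card_image)
  have "?S = 0"
  proof (rule ccontr)
    assume nz: "?S \<noteq> 0"
    have "?r = card (?y ` {..<?r})" by (rule card[symmetric])
    also have "\<dots> \<le> card {z. poly ?S z = 0}"
      using nz by (intro card_mono sub poly_roots_finite)
    also have "\<dots> \<le> degree ?S" using nz by (rule card_poly_roots_bound)
    also have "\<dots> \<le> s" by (intro degree_sum_le) (auto intro: order.trans[OF degree_monom_le])
    finally show False using s by simp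
  qed
  then have "coeff ?S j = 0" by simp
  then show ?thesis using \<open>j \<le> s\<close> by (simp add: coeff_sum)
qed

text \<open>
  The term \<open>z\<^sup>j \<theta>\<^sup>i\<close> contributes to \<open>f\<^sup>d\<^sup>-\<^sup>k h\<^sup>k\<close> a coefficient of degree at most \<open>2j + i\<close> in \<open>\<tau>\<close>. With
  \<open>N\<close> the largest weight \<open>2j + i\<close> that occurs, the coefficients of \<open>\<tau>\<^sup>N\<close> form a relation between the
  polynomials \<open>lead_poly d (N - 2j)\<close>.
\<close>

lemma no_small_diff_op:
  assumes s: "s < (d + 1) div 2" and zero: "diff_op s R (bessel0 ^ d) = 0" and "j \<le> s"
  shows "R j = 0"
proof (rule ccontr)
  assume "R j \<noteq> 0"
  define J where "J = {j. j \<le> s \<and> R j \<noteq> 0}"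
  define N where "N = Max ((\<lambda>j. 2 * j + degree (R j)) ` J)"
  have J: "finite J" "J \<noteq> {}" using \<open>R j \<noteq> 0\<close> \<open>j \<le> s\<close> by (auto simp: J_def)
  have N_ge: "2 * j + degree (R j) \<le> N" if "j \<in> J" for j
    unfolding N_def using J that by (intro Max_ge) auto
  have "N \<in> (\<lambda>j. 2 * j + degree (R j)) ` J"
    unfolding N_def using J by (intro Max_in) auto
  then obtain j0 where j0: "j0 \<le> s" "R j0 \<noteq> 0" "N = 2 * j0 + degree (R j0)"
    by (auto simp: J_def)
  define C where "C j = (if N < 2 * j then 0 else coeff (R j) (N - 2 * j))" for j
  define p where "p k = (\<Sum>j\<le>s. \<Sum>i\<le>degree (R j). monom (coeff (R j) i) (2 * j) * form_coeff d i k)" for k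
  let ?M = "\<lambda>k. bessel0 ^ (d - k) * bessel1 ^ k"
  have "diff_op s R (bessel0 ^ d) = (\<Sum>j\<le>s. \<Sum>i\<le>degree (R j). \<Sum>k\<le>d.
      fps_of_poly (monom (coeff (R j) i) (2 * j) * form_coeff d i k) * ?M k)"
    unfolding diff_op_def euler_op_altdef theta_funpow_bessel0_power sum_distrib_left
    by (simp add: fps_of_poly_mult fps_of_poly_monom mult_ac)
  also have "\<dots> = (\<Sum>j\<le>s. \<Sum>k\<le>d. \<Sum>i\<le>degree (R j).
      fps_of_poly (monom (coeff (R j) i) (2 * j) * form_coeff d i k) * ?M k)"
    by (rule sum.cong[OF refl], rule sum.swap)
  also have "\<dots> = (\<Sum>k\<le>d. \<Sum>j\<le>s. \<Sum>i\<le>degree (R j).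
      fps_of_poly (monom (coeff (R j) i) (2 * j) * form_coeff d i k) * ?M k)"
    by (rule sum.swap)
  also have "\<dots> = (\<Sum>k\<le>d. fps_of_poly (p k) * ?M k)"
    by (simp only: p_def fps_of_poly_sum sum_distrib_right)
  finally have form: "(\<Sum>k\<le>d. fps_of_poly (p k) * bessel0 ^ (d - k) * bessel1 ^ k) = 0"
    using zero by (simp add: mult.assoc)
  have p0: "p k = 0" if "k \<le> d" for k
    by (rule bessel_forms_independent[OF form that])
  have "(\<Sum>j\<le>s. smult (C j) (lead_poly d (N - 2 * j))) = 0"
  proof (rule poly_eqI)
    fix k
    show "coeff (\<Sum>j\<le>s. smult (C j) (lead_poly d (N - 2 * j))) k = coeff 0 k"
    proof (cases "k \<le> d")
      case False
      then have "coeff (lead_poly d i) k = 0" for i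
        using form_coeff_lead[of d i k] by (simp add: form_coeff_eq_0)
      then show ?thesis by (simp add: coeff_sum)
    next
      case True
      have "C j * coeff (lead_poly d (N - 2 * j)) k =
        (\<Sum>i\<le>degree (R j). coeff (monom (coeff (R j) i) (2 * j) * form_coeff d i k) N)"
        if "j \<le> s" for j
      proof (cases "R j = 0")
        case False
        then have le: "2 * j + degree (R j) \<le> N" using N_ge that by (auto simp: J_def)
        have "(\<Sum>i\<le>degree (R j). coeff (monom (coeff (R j) i) (2 * j) * form_coeff d i k) N) =
          (\<Sum>i\<le>degree (R j). if i = N - 2 * j then C j * coeff (lead_poly d (N - 2 * j)) k else 0)"
          using le form_coeff_lead[of d _ k]
          by (intro sum.cong refl) (auto simp: coeff_monom_mult C_def)
        also have "\<dots> = C j * coeff (lead_poly d (N - 2 * j)) k"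
          using le by (auto simp: C_def coeff_eq_0)
        finally show ?thesis ..
      qed (simp add: C_def)
      then have "(\<Sum>j\<le>s. C j * coeff (lead_poly d (N - 2 * j)) k) = coeff (p k) N"
        unfolding p_def coeff_sum by (intro sum.cong refl) simp
      then show ?thesis by (simp only: coeff_sum coeff_smult p0[OF True] coeff_0)
    qed
  qed
  then have "C j0 = 0"
    by (rule lead_poly_independent[OF s _ _ j0(1), rotated]) (simp add: C_def)
  then show False using j0 by (simp add: C_def)
qed

section \<open>The minimal width\<close>

theorem mainTheorem7:
  fixes d :: nat and x :: "nat \<Rightarrow> complex"
  assumes "d \<ge> 3"
    and "\<And>n. x n = multinomial_square_sum d n"
  shows "P_recurrent ((d + 1) div 2) x \<and> (\<forall>s < (d + 1) div 2. \<not> P_recurrent s x)"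
proof (intro conjI allI impI notI)
  show "P_recurrent ((d + 1) div 2) x"
    using assms(2) by (rule multinomial_square_sum_recurrent)
next
  fix s assume s: "s < (d + 1) div 2" and rec: "P_recurrent s x"
  have "fps_nth (bessel0 ^ d) n = (if even n then x (n div 2) / (fact (n div 2))\<^sup>2 else 0)" for n
    by (simp add: bessel0_power_nth assms(2))
  from recurrent_imp_diff_op[OF this rec] obtain R
    where "\<exists>j\<le>s. R j \<noteq> 0" "diff_op s R (bessel0 ^ d) = 0" .
  with no_small_diff_op[OF s] show False by blast
qed

end
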